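(* Let $(G,\rho)$ be a unimodular random rooted graph and $\xi$ a percolation of $(G,\rho)$ such that every vertex of the subgraph $G_D:=G[\xi]$ has degree at most $D$, for some positive integer $D$. Then for every $\alpha>0$ there exists a site percolation $\omega_\alpha$ of $(G,\rho,\xi)$ (i.e. $(G,\rho,\xi,\omega_\alpha)$ is unimodular) with rate at most $\alpha$ such that, almost surely, every infinite connected component of $G_D[\omega_\alpha]$ has inner vertex-expansion constant at least $\alpha$.
   Context: A random rooted graph $(G,\rho)$ (root in a connected locally finite graph) is unimodular if for every Borel $f\ge0$ on doubly rooted graphs (possibly with marks), $\mathbb E[\sum_o f(G,\rho,o)]=\mathbb E[\sum_o f(G,o,\rho)]$. A marking is a random function from $V(G)\cup E(G)$ to a Polish space such that the marked rooted graph is unimodular. A percolation is a $\{0,1\}$-marking in which an edge is open (value 1) only if both endpoints are open; a site percolation additionally has every edge with both endpoints open being open. $G[\omega]$ denotes the subgraph of open vertices and edges; the rate of $\omega$ is $\mathbb P[\omega(\rho)=0]$. For a graph $G$ and finite $K\subseteq V(G)$, $\partial_{\mathrm{in}}K$ is the set of vertices of $K$ adjacent to some vertex outside $K$; the inner vertex-expansion constant of $G$ is $\inf\{|\partial_{\mathrm{in}}K|/|K|:\emptyset\ne K\subseteq V(G)\text{ finite}\}$. *)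

theory Defs
  imports "HOL-Probability.Probability"
begin

text \<open>
Encoding. A (vertex- and edge-)marked graph with vertices in nat is a pair
  (vm, em) :: (nat \<Rightarrow> 'v option) \<times> (nat \<Rightarrow> nat \<Rightarrow> 'e option):
vertex v is present iff vm v \<noteq> None (and then vm v is its mark);
{u,v} is an edge iff em u v \<noteq> None (and then em u v is its mark).
A rooted marked graph is a pair (G, root); a doubly rooted one is ((G, root), other).
Random (doubly) rooted graphs are probability measures on these labelled
representatives; Borel functions on the space of isomorphism classes are represented
by measurable functions invariant under all relabellings (bijections of nat).
\<close>

type_synonym ('v, 'e) mgraph = "(nat \<Rightarrow> 'v option) \<times> (nat \<Rightarrow> nat \<Rightarrow> 'e option)"

definition gspace :: "('v, 'e) mgraph measure" where
  "gspace = (PiM UNIV (\<lambda>_. count_space UNIV)) \<Otimes>\<^sub>M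
            (PiM UNIV (\<lambda>_. PiM UNIV (\<lambda>_. count_space UNIV)))"

definition rspace :: "(('v, 'e) mgraph \<times> nat) measure" where
  "rspace = gspace \<Otimes>\<^sub>M count_space UNIV"

definition drspace :: "((('v, 'e) mgraph \<times> nat) \<times> nat) measure" where
  "drspace = rspace \<Otimes>\<^sub>M count_space UNIV"

definition vert :: "('v, 'e) mgraph \<Rightarrow> nat \<Rightarrow> bool" where
  "vert G v \<longleftrightarrow> fst G v \<noteq> None"

definition adj :: "('v, 'e) mgraph \<Rightarrow> nat \<Rightarrow> nat \<Rightarrow> bool" where
  "adj G u v \<longleftrightarrow> snd G u v \<noteq> None"

definition wf_rooted :: "('v, 'e) mgraph \<times> nat \<Rightarrow> bool" where
  "wf_rooted x \<longleftrightarrow> (let G = fst x; r = snd x in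
     vert G r \<and>
     (\<forall>u v. adj G u v \<longrightarrow> vert G u \<and> vert G v \<and> u \<noteq> v) \<and>
     (\<forall>u v. snd G u v = snd G v u) \<and>
     (\<forall>u. finite {v. adj G u v}) \<and>
     (\<forall>u. vert G u \<longrightarrow> (adj G)\<^sup>*\<^sup>* r u))"

definition relabel :: "(nat \<Rightarrow> nat) \<Rightarrow> ('v, 'e) mgraph \<Rightarrow> ('v, 'e) mgraph" where
  "relabel \<pi> G = (\<lambda>v. fst G (inv \<pi> v), \<lambda>u v. snd G (inv \<pi> u) (inv \<pi> v))"

definition invariant2 :: "((('v, 'e) mgraph \<times> nat) \<times> nat \<Rightarrow> ennreal) \<Rightarrow> bool" where
  "invariant2 f \<longleftrightarrow> (\<forall>\<pi> G r w. bij \<pi> \<longrightarrow> f ((relabel \<pi> G, \<pi> r), \<pi> w) = f ((G, r), w))"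

definition invariant1 :: "(('v, 'e) mgraph \<times> nat \<Rightarrow> ennreal) \<Rightarrow> bool" where
  "invariant1 g \<longleftrightarrow> (\<forall>\<pi> G r. bij \<pi> \<longrightarrow> g (relabel \<pi> G, \<pi> r) = g (G, r))"

definition unimodular :: "(('v, 'e) mgraph \<times> nat) measure \<Rightarrow> bool" where
  "unimodular M \<longleftrightarrow> prob_space M \<and> sets M = sets rspace \<and> (AE x in M. wf_rooted x) \<and>
     (\<forall>f \<in> borel_measurable drspace. invariant2 f \<longrightarrow>
        (\<integral>\<^sup>+ x. (\<Sum>w. if vert (fst x) w then f ((fst x, snd x), w) else 0) \<partial>M) =
        (\<integral>\<^sup>+ x. (\<Sum>w. if vert (fst x) w then f ((fst x, w), snd x) else 0) \<partial>M))"

definition is_percolation_marks :: "(bool, bool) mgraph \<Rightarrow> bool" where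
  "is_percolation_marks G \<longleftrightarrow>
     (\<forall>u v. snd G u v = Some True \<longrightarrow> fst G u = Some True \<and> fst G v = Some True)"

text \<open>Forget the second coordinate of the marks (the added marking omega).\<close>
definition forget :: "('a \<times> 'b, 'c \<times> 'd) mgraph \<Rightarrow> ('a, 'c) mgraph" where
  "forget G = (\<lambda>v. map_option fst (fst G v), \<lambda>u v. map_option fst (snd G u v))"

definition site_perc_snd :: "(bool \<times> bool, bool \<times> bool) mgraph \<Rightarrow> bool" where
  "site_perc_snd G \<longleftrightarrow>
     (\<forall>u v. snd G u v \<noteq> None \<longrightarrow>
        (snd (the (snd G u v)) \<longleftrightarrow> snd (the (fst G u)) \<and> snd (the (fst G v))))"

text \<open>The subgraph G_D[omega]: vertices/edges open for both xi and omega.\<close>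
definition sub_adj :: "(bool \<times> bool, bool \<times> bool) mgraph \<Rightarrow> nat \<Rightarrow> nat \<Rightarrow> bool" where
  "sub_adj G u v \<longleftrightarrow> snd G u v = Some (True, True)"

definition sub_vert :: "(bool \<times> bool, bool \<times> bool) mgraph \<Rightarrow> nat \<Rightarrow> bool" where
  "sub_vert G v \<longleftrightarrow> fst G v = Some (True, True)"

definition components :: "(nat \<Rightarrow> bool) \<Rightarrow> (nat \<Rightarrow> nat \<Rightarrow> bool) \<Rightarrow> nat set set" where
  "components V A = {{u. (\<lambda>a b. A a b)\<^sup>*\<^sup>* v u} | v. V v}"

definition inner_boundary :: "(nat \<Rightarrow> nat \<Rightarrow> bool) \<Rightarrow> nat set \<Rightarrow> nat set \<Rightarrow> nat set" where
  "inner_boundary A C K = {v \<in> K. \<exists>u \<in> C - K. A v u}"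

definition inner_expansion :: "(nat \<Rightarrow> nat \<Rightarrow> bool) \<Rightarrow> nat set \<Rightarrow> real" where
  "inner_expansion A C = Inf {real (card (inner_boundary A C K)) / real (card K) | K.
                               K \<noteq> {} \<and> K \<subseteq> C \<and> finite K}"

end

theory Submission
  imports Defs
begin

text \<open>
  Proof idea. Toss independent fair coins \<open>U n v\<close>. In round \<open>n\<close>, look at the finite clusters \<open>K\<close> of
  alive vertices with \<open>U n = True\<close>; if \<open>K\<close> violates the inner expansion bound \<open>\<alpha>\<close> relative to the
  alive vertices, shut its inner boundary and remove all of \<open>K\<close> from the alive vertices. The removed
  sets are pairwise disjoint and each has fewer than \<open>\<alpha> * card K\<close> shut vertices, so mass transport
  bounds the rate by \<open>\<alpha>\<close>. What is left of a removed set lies in finite components. A finite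
  connected set that stays alive forever and violates the bound in the limit also violates it in all
  late rounds, and by Borel-Cantelli it is almost surely a cluster in one of them, a contradiction.
  The coins are invariant under relabelling and the construction is equivariant, so averaging over the
  coins reduces unimodularity of the marked graph to that of the original one.
\<close>

section \<open>Peeling of violating clusters for a fixed graph and fixed coins\<close>

definition bdry :: "(nat \<Rightarrow> nat \<Rightarrow> bool) \<Rightarrow> (nat \<Rightarrow> bool) \<Rightarrow> nat set \<Rightarrow> nat set" where
  "bdry A W K = {v \<in> K. \<exists>u. u \<notin> K \<and> W u \<and> A v u}"

text \<open>Connectedness of the subgraph induced on \<open>K\<close>, expressed by cuts instead of
  paths. For finite \<open>K\<close> this is a finite condition on the edges, which makes it easy to
  measure.\<close>

definition indecomposable :: "(nat \<Rightarrow> nat \<Rightarrow> bool) \<Rightarrow> nat set \<Rightarrow> bool" where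
  "indecomposable A K \<longleftrightarrow> (\<forall>S. S \<subseteq> K \<and> S \<noteq> {} \<and> S \<noteq> K \<longrightarrow> (\<exists>v\<in>S. \<exists>u\<in>K - S. A v u))"

text \<open>Two ambient sets occur. Maximality is relative to the vertices satisfying both
  \<open>W\<close> and \<open>X\<close>, so \<open>K\<close> is a full cluster of those; the
  boundary counts all neighbours satisfying \<open>W\<close>, whatever their coin.\<close>

definition is_cell :: "real \<Rightarrow> (nat \<Rightarrow> nat \<Rightarrow> bool) \<Rightarrow> (nat \<Rightarrow> bool) \<Rightarrow> (nat \<Rightarrow> bool) \<Rightarrow> nat set \<Rightarrow> bool" where
  "is_cell \<alpha> A W X K \<longleftrightarrow> finite K \<and> K \<noteq> {} \<and> (\<forall>v\<in>K. W v \<and> X v) \<and> indecomposable A K \<and>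
     (\<forall>v\<in>K. \<forall>u. u \<notin> K \<and> A v u \<longrightarrow> \<not> (W u \<and> X u)) \<and>
     real (card (bdry A W K)) < \<alpha> * real (card K)"

primrec alive :: "real \<Rightarrow> (nat \<Rightarrow> nat \<Rightarrow> bool) \<Rightarrow> (nat \<Rightarrow> bool) \<Rightarrow> (nat \<Rightarrow> nat \<Rightarrow> bool) \<Rightarrow> nat \<Rightarrow> nat \<Rightarrow> bool" where
  "alive \<alpha> A V U 0 = V"
| "alive \<alpha> A V U (Suc n) = (\<lambda>v. alive \<alpha> A V U n v \<and> (\<forall>K. is_cell \<alpha> A (alive \<alpha> A V U n) (U n) K \<longrightarrow> v \<notin> K))"

definition cell_at :: "real \<Rightarrow> (nat \<Rightarrow> nat \<Rightarrow> bool) \<Rightarrow> (nat \<Rightarrow> bool) \<Rightarrow> (nat \<Rightarrow> nat \<Rightarrow> bool) \<Rightarrow> nat \<Rightarrow> nat set \<Rightarrow> bool" where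
  "cell_at \<alpha> A V U n K \<longleftrightarrow> is_cell \<alpha> A (alive \<alpha> A V U n) (U n) K"

text \<open>Only the boundary of a removed cell is shut. Its interior is no longer alive but stays
  open, enclosed by the shut boundary.\<close>

definition shut :: "real \<Rightarrow> (nat \<Rightarrow> nat \<Rightarrow> bool) \<Rightarrow> (nat \<Rightarrow> bool) \<Rightarrow> (nat \<Rightarrow> nat \<Rightarrow> bool) \<Rightarrow> nat \<Rightarrow> bool" where
  "shut \<alpha> A V U v \<longleftrightarrow> (\<exists>n K. cell_at \<alpha> A V U n K \<and> v \<in> bdry A (alive \<alpha> A V U n) K)"

lemma bdry_subset: "bdry A W K \<subseteq> K"
  by (auto simp: bdry_def)

lemma alive_antimono: "m \<le> n \<Longrightarrow> alive \<alpha> A V U n v \<Longrightarrow> alive \<alpha> A V U m v"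
  by (induction n) (auto simp: le_Suc_eq)

lemma alive_imp_V: "alive \<alpha> A V U n v \<Longrightarrow> V v"
  using alive_antimono[of 0 n] by simp

lemma cell_at_finite: "cell_at \<alpha> A V U n K \<Longrightarrow> finite K"
  and cell_at_alive: "cell_at \<alpha> A V U n K \<Longrightarrow> v \<in> K \<Longrightarrow> alive \<alpha> A V U n v"
  and cell_at_not_alive: "cell_at \<alpha> A V U n K \<Longrightarrow> v \<in> K \<Longrightarrow> \<not> alive \<alpha> A V U (Suc n) v"
  and cell_at_card: "cell_at \<alpha> A V U n K \<Longrightarrow>
    real (card (bdry A (alive \<alpha> A V U n) K)) < \<alpha> * real (card K)"
  by (auto simp: cell_at_def is_cell_def)

text \<open>If \<open>K\<close> were not inside \<open>K'\<close>, a cut of \<open>K\<close> along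
  \<open>K \<inter> K'\<close> would give an edge from \<open>K'\<close> to a vertex of
  \<open>K\<close> outside \<open>K'\<close>. That vertex satisfies \<open>W\<close> and
  \<open>X\<close>, against the maximality of \<open>K'\<close>.\<close>

lemma is_cell_unique:
  assumes "is_cell \<alpha> A W X K" "is_cell \<alpha> A W X K'" "v \<in> K" "v \<in> K'"
  shows "K = K'"
proof -
  have sub: "K \<subseteq> K'" if K: "is_cell \<alpha> A W X K" and K': "is_cell \<alpha> A W X K'" and v: "v \<in> K" "v \<in> K'" for K K'
  proof (rule ccontr)
    assume "\<not> K \<subseteq> K'"
    then have "K \<inter> K' \<subseteq> K" "K \<inter> K' \<noteq> {}" "K \<inter> K' \<noteq> K" using v by auto
    then obtain a b where "a \<in> K \<inter> K'" "b \<in> K - K \<inter> K'" "A a b"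
      using K unfolding is_cell_def indecomposable_def by metis
    then show False using K K' unfolding is_cell_def by blast
  qed
  show ?thesis using sub[OF assms] sub[OF assms(2,1,4,3)] by blast
qed

text \<open>The vertices of a cell are dead from the next round on, so cells of different rounds are
  disjoint. Hence a vertex is charged for at most one cell.\<close>

lemma cell_at_unique:
  assumes "cell_at \<alpha> A V U n K" "cell_at \<alpha> A V U m K'" "v \<in> K" "v \<in> K'"
  shows "n = m \<and> K = K'"
proof -
  have le: "m \<le> n" if "cell_at \<alpha> A V U n K" "cell_at \<alpha> A V U m K'" "v \<in> K" "v \<in> K'" for n m K K'
    using cell_at_not_alive[OF that(1,3)] cell_at_alive[OF that(2,4)] alive_antimono[of "Suc n" m]
    by (meson not_less_eq_eq)
  have "n = m" using le[OF assms] le[OF assms(2,1,4,3)] by simp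
  then show ?thesis using assms is_cell_unique unfolding cell_at_def by blast
qed

lemma dead_imp_cell_at:
  assumes "V v" "\<not> alive \<alpha> A V U n v"
  obtains m K where "m < n" "cell_at \<alpha> A V U m K" "v \<in> K"
  using assms
proof (induction n arbitrary: thesis)
  case (Suc n)
  show ?case
  proof (cases "alive \<alpha> A V U n v")
    case True
    then show ?thesis using Suc.prems unfolding cell_at_def by auto
  next
    case False
    show ?thesis
    proof (rule Suc.IH[OF _ Suc.prems(2) False])
      fix m K assume "m < n" "cell_at \<alpha> A V U m K" "v \<in> K"
      then show thesis using Suc.prems(1)[of m K] by simp
    qed
  qed
qed simp

lemma alive_imp_not_shut:
  assumes "\<And>n. alive \<alpha> A V U n v" shows "\<not> shut \<alpha> A V U v"
proof
  assume "shut \<alpha> A V U v"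
  then obtain n K where K: "cell_at \<alpha> A V U n K" "v \<in> K"
    unfolding shut_def using bdry_subset by blast
  show False using cell_at_not_alive[OF K] assms by contradiction
qed

text \<open>The open part of a removed cell cannot be left through open vertices. If the outer
  neighbour \<open>u\<close> is alive in round \<open>n\<close>, then \<open>v\<close> is on the
  boundary and shut. If \<open>u\<close> died earlier, then \<open>v\<close> was alive outside the
  cell of \<open>u\<close>, so \<open>u\<close> was on the boundary of that cell and is
  shut.\<close>

lemma unshut_cell_closed:
  assumes sym: "symp A" and AV: "\<forall>u v. A u v \<longrightarrow> V u"
    and K: "cell_at \<alpha> A V U n K" "v \<in> K" "\<not> shut \<alpha> A V U v"
    and u: "A v u" "\<not> shut \<alpha> A V U u"
  shows "u \<in> K"
proof (rule ccontr)
  assume uK: "u \<notin> K"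
  have vb: "v \<notin> bdry A (alive \<alpha> A V U n) K" using K unfolding shut_def by blast
  then have "\<not> alive \<alpha> A V U n u" using K u uK unfolding bdry_def by blast
  moreover have "V u" using sympD[OF sym] AV u by blast
  ultimately obtain m K' where m: "m < n" "cell_at \<alpha> A V U m K'" "u \<in> K'"
    using dead_imp_cell_at by blast
  have "alive \<alpha> A V U (Suc m) v"
    using cell_at_alive[OF K(1,2)] alive_antimono[of "Suc m" n] m(1) by simp
  then have "alive \<alpha> A V U m v" "v \<notin> K'" using m unfolding cell_at_def by auto
  then have "u \<in> bdry A (alive \<alpha> A V U m) K'" using m sympD[OF sym u(1)] unfolding bdry_def by blast
  then show False using m u unfolding shut_def by blast
qed

section \<open>Expansion of the open vertices, for coins that show every finite pattern\<close>

text \<open>A set of least cardinality violating the isoperimetric inequality is connected, because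
  cutting it along a union of its components splits the boundary as well.\<close>
lemma indecomposable_violator:
  assumes sym: "symp A"
    and "finite K" "K \<noteq> {}" "real (card (bdry A W K)) < \<alpha> * real (card K)"
  obtains S where "S \<subseteq> K" "S \<noteq> {}" "indecomposable A S" "real (card (bdry A W S)) < \<alpha> * real (card S)"
  using assms(2-)
proof (induction "card K" arbitrary: K thesis rule: less_induct)
  case less
  show ?case
  proof (cases "indecomposable A K")
    case True
    then show ?thesis using less.prems by blast
  next
    case False
    then obtain S where S: "S \<subseteq> K" "S \<noteq> {}" "S \<noteq> K" and no: "\<And>v u. v \<in> S \<Longrightarrow> u \<in> K - S \<Longrightarrow> \<not> A v u"
      unfolding indecomposable_def by blast
    define T where "T = K - S"
    have fin: "finite S" "finite T" using S less.prems finite_subset T_def by auto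
    have T: "T \<subseteq> K" "T \<noteq> {}" "T \<subset> K" "S \<subset> K" using S T_def by auto
    \<comment> \<open>No edge joins \<open>S\<close> and \<open>T\<close>, so a neighbour of
      \<open>S\<close> outside \<open>S\<close> is already outside \<open>K\<close>, and likewise
      for \<open>T\<close>.\<close>
    have "bdry A W S \<union> bdry A W T \<subseteq> bdry A W K"
      using no sympD[OF sym] S unfolding bdry_def T_def by blast
    moreover have "bdry A W S \<inter> bdry A W T = {}" using bdry_subset[of A W] T_def by blast
    moreover have "finite (bdry A W K)" "finite (bdry A W S)" "finite (bdry A W T)"
      using fin less.prems bdry_subset finite_subset by metis+
    ultimately have 1: "card (bdry A W S) + card (bdry A W T) \<le> card (bdry A W K)"
      using card_mono card_Un_disjoint by metis
    have "card K = card S + card T" using S fin T_def less.prems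
      by (metis Diff_disjoint Un_Diff_cancel card_Un_disjoint sup.absorb2)
    then have "\<alpha> * real (card K) = \<alpha> * real (card S) + \<alpha> * real (card T)" by (simp add: algebra_simps)
    then consider "real (card (bdry A W S)) < \<alpha> * real (card S)" | "real (card (bdry A W T)) < \<alpha> * real (card T)"
      using 1 less.prems(4) by linarith
    then show ?thesis
    proof cases
      case 1
      then show ?thesis using less.hyps[of S] less.prems S T fin
        by (metis order.trans psubset_card_mono)
    next
      case 2
      then show ?thesis using less.hyps[of T] less.prems T fin
        by (metis order.trans psubset_card_mono)
    qed
  qed
qed

text \<open>The only almost sure property of the coins that enters the argument for a fixed graph:
  each finite pattern appears in arbitrarily late rounds.\<close>

definition seen_io :: "(nat \<Rightarrow> nat \<Rightarrow> bool) \<Rightarrow> bool" where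
  "seen_io U \<longleftrightarrow> (\<forall>S T N. finite S \<longrightarrow> finite T \<longrightarrow> S \<inter> T = {} \<longrightarrow>
     (\<exists>n\<ge>N. (\<forall>v\<in>S. U n v) \<and> (\<forall>v\<in>T. \<not> U n v)))"

text \<open>The set \<open>L\<close> is a finite trap, which no edge between unshut vertices leaves.
  If a vertex of \<open>K\<close> ever dies, its cell serves as \<open>L\<close>. If all of
  \<open>K\<close> lives forever, some late round would have to remove a part of \<open>K\<close>,
  so this case is contradictory.\<close>

lemma expansion_or_trapped:
  assumes sym: "symp A" and AV: "\<forall>u v. A u v \<longrightarrow> V u"
    and lf: "\<And>v. finite {u. A v u}" and U: "seen_io U"
    and K: "finite K" "K \<noteq> {}" "\<And>v. v \<in> K \<Longrightarrow> V v \<and> \<not> shut \<alpha> A V U v"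
    and small: "real (card (bdry A (\<lambda>u. \<not> shut \<alpha> A V U u) K)) < \<alpha> * real (card K)"
  shows "\<exists>L. finite L \<and> K \<inter> L \<noteq> {} \<and> (\<forall>v\<in>L. \<forall>u. A v u \<longrightarrow> \<not> shut \<alpha> A V U v \<longrightarrow> \<not> shut \<alpha> A V U u \<longrightarrow> u \<in> L)"
proof (cases "\<exists>v\<in>K. \<exists>n. \<not> alive \<alpha> A V U n v")
  case True
  then obtain v n where v: "v \<in> K" "\<not> alive \<alpha> A V U n v" by blast
  then obtain m L where L: "cell_at \<alpha> A V U m L" "v \<in> L" using dead_imp_cell_at K(3) by metis
  have "u' \<in> L" if "v' \<in> L" "A v' u'" "\<not> shut \<alpha> A V U v'" "\<not> shut \<alpha> A V U u'" for v' u'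
    using unshut_cell_closed[OF sym AV] L that by blast
  moreover have "finite L" "K \<inter> L \<noteq> {}" using cell_at_finite[OF L(1)] L(2) v(1) by auto
  ultimately show ?thesis by (intro exI[of _ L] conjI) auto
next
  case False
  then have al: "\<And>v n. v \<in> K \<Longrightarrow> alive \<alpha> A V U n v" by blast
  let ?W = "\<lambda>u. \<not> shut \<alpha> A V U u"
  obtain S where S: "S \<subseteq> K" "S \<noteq> {}" "indecomposable A S" "real (card (bdry A ?W S)) < \<alpha> * real (card S)"
    using indecomposable_violator[of A K ?W, OF sym] K small by metis
  \<comment> \<open>\<open>T\<close> is the outer neighbourhood of \<open>S\<close>, finite by local
    finiteness. Coins that are true on \<open>S\<close> and false on \<open>T\<close> make
    \<open>S\<close> a full cluster of the round.\<close>
  define T where "T = (\<Union>v\<in>S. {u. A v u}) - S"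
  have fin: "finite S" "finite T" using finite_subset[OF S(1) K(1)] lf T_def by auto
  \<comment> \<open>From some round on, every vertex of \<open>T\<close> that ever dies is already
    dead.\<close>
  have "\<exists>k. \<forall>n\<ge>k. \<forall>u\<in>T. alive \<alpha> A V U n u \<longrightarrow> (\<forall>m. alive \<alpha> A V U m u)"
  proof -
    \<comment> \<open>For a vertex that never dies the choice \<open>f u\<close> is arbitrary; this
      is harmless, since the claim about such a vertex is trivial.\<close>
    define f where "f u = (SOME k. \<not> alive \<alpha> A V U k u)" for u
    have f: "\<not> alive \<alpha> A V U (f u) u" if "\<not> alive \<alpha> A V U m u" for u m
      unfolding f_def using that by (rule someI)
    have "alive \<alpha> A V U m u" if "n \<ge> Max (f ` T)" "u \<in> T" "alive \<alpha> A V U n u" for n u m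
    proof -
      have "f u \<le> n" using that fin by (meson Max_ge finite_imageI imageI order_trans)
      then show ?thesis using f that alive_antimono by blast
    qed
    then show ?thesis by blast
  qed
  then obtain k where k: "\<And>n u m. n \<ge> k \<Longrightarrow> u \<in> T \<Longrightarrow> alive \<alpha> A V U n u \<Longrightarrow> alive \<alpha> A V U m u" by blast
  have "S \<inter> T = {}" using T_def by auto
  then obtain n where n: "n \<ge> k" "\<And>v. v \<in> S \<Longrightarrow> U n v" "\<And>v. v \<in> T \<Longrightarrow> \<not> U n v"
    using U fin unfolding seen_io_def by meson
  \<comment> \<open>A vertex of \<open>T\<close> alive in round \<open>n\<close> stays alive forever
    and is therefore never shut. Thus round \<open>n\<close> inherits the violation from the
    limit.\<close>
  have "bdry A (alive \<alpha> A V U n) S \<subseteq> bdry A ?W S"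
    using k[OF n(1)] alive_imp_not_shut[of \<alpha> A V U] unfolding bdry_def T_def by blast
  then have "card (bdry A (alive \<alpha> A V U n) S) \<le> card (bdry A ?W S)"
    using fin bdry_subset by (meson card_mono finite_subset)
  then have "cell_at \<alpha> A V U n S"
    using S fin al n(2) n(3)[unfolded T_def] unfolding cell_at_def is_cell_def by fastforce
  note cell = this
  obtain v where v: "v \<in> S" using S(2) by auto
  then have "alive \<alpha> A V U (Suc n) v" using al S(1) by blast
  then show ?thesis using cell_at_not_alive[OF cell v] by contradiction
qed

section \<open>Mass transport from cells to their boundaries\<close>

text \<open>Every vertex of a cell \<open>K\<close> sends mass \<open>1 / card K\<close> to each boundary vertex of \<open>K\<close>. Hence it sends
  less than \<open>\<alpha>\<close> altogether, while every boundary vertex receives exactly 1. The sum over \<open>k\<close> has at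
  most one nonzero term; it avoids choosing the cell of a vertex.\<close>

definition cell_bdry :: "real \<Rightarrow> (nat \<Rightarrow> nat \<Rightarrow> bool) \<Rightarrow> (nat \<Rightarrow> bool) \<Rightarrow> (nat \<Rightarrow> nat \<Rightarrow> bool) \<Rightarrow> nat \<Rightarrow> nat \<Rightarrow> nat \<Rightarrow> bool" where
  "cell_bdry \<alpha> A V U k r w \<longleftrightarrow>
     (\<exists>n K. cell_at \<alpha> A V U n K \<and> card K = k \<and> r \<in> K \<and> w \<in> bdry A (alive \<alpha> A V U n) K)"

definition transport :: "real \<Rightarrow> (nat \<Rightarrow> nat \<Rightarrow> bool) \<Rightarrow> (nat \<Rightarrow> bool) \<Rightarrow> (nat \<Rightarrow> nat \<Rightarrow> bool) \<Rightarrow> nat \<Rightarrow> nat \<Rightarrow> ennreal" where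
  "transport \<alpha> A V U r w = (\<Sum>k. if cell_bdry \<alpha> A V U k r w then ennreal (1 / real k) else 0)"

lemma transport_eq:
  assumes K: "cell_at \<alpha> A V U n K" "r \<in> K"
  shows "transport \<alpha> A V U r w =
    (if w \<in> bdry A (alive \<alpha> A V U n) K then ennreal (1 / real (card K)) else 0)"
proof -
  have iff: "cell_bdry \<alpha> A V U k r w \<longleftrightarrow> k = card K \<and> w \<in> bdry A (alive \<alpha> A V U n) K" for k
    using cell_at_unique[OF K(1) _ K(2)] K unfolding cell_bdry_def by metis
  show ?thesis unfolding transport_def iff
    by (subst suminf_finite[of "{card K}"]) auto
qed

lemma transport_eq_0:
  assumes "\<And>n K. cell_at \<alpha> A V U n K \<Longrightarrow> r \<notin> K"
  shows "transport \<alpha> A V U r w = 0"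
proof -
  have "\<not> cell_bdry \<alpha> A V U k r w" for k using assms unfolding cell_bdry_def by blast
  then show ?thesis unfolding transport_def by simp
qed

lemma transport_sent:
  assumes "\<alpha> > 0"
  shows "(\<Sum>w. transport \<alpha> A V U r w) \<le> ennreal \<alpha>"
proof (cases "\<exists>n K. cell_at \<alpha> A V U n K \<and> r \<in> K")
  case True
  then obtain n K where K: "cell_at \<alpha> A V U n K" "r \<in> K" by blast
  let ?b = "bdry A (alive \<alpha> A V U n) K"
  have fin: "finite K" using cell_at_finite[OF K(1)] .
  then have finb: "finite ?b" using finite_subset[OF bdry_subset] by blast
  have pos: "card K > 0" using fin K card_gt_0_iff by blast
  have "(\<Sum>w. transport \<alpha> A V U r w) = (\<Sum>w\<in>?b. ennreal (1 / real (card K)))"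
    unfolding transport_eq[OF K] by (subst suminf_finite[of ?b]) (use finb in auto)
  also have "\<dots> = ennreal (real (card ?b) / real (card K))"
    by (simp add: ennreal_of_nat_eq_real_of_nat flip: ennreal_mult)
  also have "\<dots> \<le> ennreal \<alpha>"
    using cell_at_card[OF K(1)] pos by (intro ennreal_leI) (simp add: field_simps)
  finally show ?thesis .
next
  case False
  then have "transport \<alpha> A V U r w = 0" for w by (intro transport_eq_0) blast
  then show ?thesis by simp
qed

lemma transport_received:
  assumes r: "shut \<alpha> A V U r"
  shows "(\<Sum>w. if V w then transport \<alpha> A V U w r else 0) \<ge> 1"
proof -
  obtain n K where K: "cell_at \<alpha> A V U n K" "r \<in> bdry A (alive \<alpha> A V U n) K"
    using r unfolding shut_def by blast
  have fin: "finite K" using cell_at_finite[OF K(1)] .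
  have pos: "card K > 0" using fin K bdry_subset card_gt_0_iff by blast
  have "1 = (\<Sum>w\<in>K. ennreal (1 / real (card K)))"
    using pos by (simp add: ennreal_of_nat_eq_real_of_nat flip: ennreal_mult)
  also have "\<dots> = (\<Sum>w\<in>K. if V w then transport \<alpha> A V U w r else 0)"
    using cell_at_alive[OF K(1)] alive_imp_V K transport_eq[OF K(1)] by (intro sum.cong) force+
  also have "\<dots> \<le> (\<Sum>w. if V w then transport \<alpha> A V U w r else 0)"
    using fin by (intro sum_le_suminf) auto
  finally show ?thesis .
qed

section \<open>Equivariance of the construction under bijections of the vertices\<close>

context
  fixes \<sigma> :: "nat \<Rightarrow> nat"
  assumes \<sigma>: "bij \<sigma>"
begin

text \<open>Since \<sigma> is onto, every set is an image. This lets the quantifiers over sets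
  inside the definitions be transported along \<sigma> by rewriting.\<close>

lemma all_image: "(\<forall>K. P (\<sigma> ` K)) \<longleftrightarrow> (\<forall>K. P K)"
proof
  assume *: "\<forall>K. P (\<sigma> ` K)"
  show "\<forall>K. P K"
  proof
    fix K
    have "\<sigma> ` (\<sigma> -` K) = K" using bij_is_surj[OF \<sigma>] by (simp add: surj_image_vimage_eq)
    then show "P K" using *[rule_format, of "\<sigma> -` K"] by simp
  qed
qed simp

lemma ex_image: "(\<exists>K. P (\<sigma> ` K)) \<longleftrightarrow> (\<exists>K. P K)"
proof
  assume "\<exists>K. P K"
  then obtain K where K: "P K" by (rule exE)
  have "\<sigma> ` (\<sigma> -` K) = K" using bij_is_surj[OF \<sigma>] by (simp add: surj_image_vimage_eq)
  then show "\<exists>K. P (\<sigma> ` K)" using K by (intro exI[of _ "\<sigma> -` K"]) simp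
next
  assume "\<exists>K. P (\<sigma> ` K)"
  then obtain K where "P (\<sigma> ` K)" by (rule exE)
  then show "\<exists>K. P K" by (rule exI)
qed

text \<open>Equivariance is stated throughout as a pullback along \<sigma>. It is applied later with
  \<sigma> the inverse of the relabelling, because \<open>relabel\<close> composes the marks with
  \<open>inv \<pi>\<close>.\<close>

lemma bdry_image: "\<sigma> v \<in> bdry A W (\<sigma> ` K) \<longleftrightarrow> v \<in> bdry (\<lambda>u v. A (\<sigma> u) (\<sigma> v)) (\<lambda>v. W (\<sigma> v)) K"
proof -
  have "(\<exists>u. P u) \<longleftrightarrow> (\<exists>u. P (\<sigma> u))" for P using \<sigma> by (metis bij_pointE)
  from this[of "\<lambda>u. u \<notin> \<sigma> ` K \<and> W u \<and> A (\<sigma> v) u"] show ?thesis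
    using bij_is_inj[OF \<sigma>] by (simp add: bdry_def inj_image_mem_iff)
qed

lemma bdry_image_eq: "bdry A W (\<sigma> ` K) = \<sigma> ` bdry (\<lambda>u v. A (\<sigma> u) (\<sigma> v)) (\<lambda>v. W (\<sigma> v)) K"
proof (intro set_eqI iffI)
  fix v assume v: "v \<in> bdry A W (\<sigma> ` K)"
  then obtain u where "v = \<sigma> u" using bdry_subset by blast
  then show "v \<in> \<sigma> ` bdry (\<lambda>u v. A (\<sigma> u) (\<sigma> v)) (\<lambda>v. W (\<sigma> v)) K" using v bdry_image by blast
next
  fix v assume "v \<in> \<sigma> ` bdry (\<lambda>u v. A (\<sigma> u) (\<sigma> v)) (\<lambda>v. W (\<sigma> v)) K"
  then show "v \<in> bdry A W (\<sigma> ` K)" using bdry_image by blast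
qed

lemma indecomposable_image: "indecomposable A (\<sigma> ` K) \<longleftrightarrow> indecomposable (\<lambda>u v. A (\<sigma> u) (\<sigma> v)) K"
proof -
  have inj: "inj \<sigma>" using \<sigma> bij_is_inj by blast
  let ?Q = "\<lambda>S. S \<subseteq> \<sigma> ` K \<and> S \<noteq> {} \<and> S \<noteq> \<sigma> ` K \<longrightarrow> (\<exists>v\<in>S. \<exists>u\<in>\<sigma> ` K - S. A v u)"
  have "?Q (\<sigma> ` S) \<longleftrightarrow> (S \<subseteq> K \<and> S \<noteq> {} \<and> S \<noteq> K \<longrightarrow> (\<exists>v\<in>S. \<exists>u\<in>K - S. A (\<sigma> v) (\<sigma> u)))" for S
    unfolding inj_image_subset_iff[OF inj] inj_image_eq_iff[OF inj] image_set_diff[OF inj, symmetric]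
    by simp
  then show ?thesis
    unfolding indecomposable_def all_image[of ?Q, symmetric] by simp
qed

lemma is_cell_image:
  "is_cell \<alpha> A W X (\<sigma> ` K) \<longleftrightarrow> is_cell \<alpha> (\<lambda>u v. A (\<sigma> u) (\<sigma> v)) (\<lambda>v. W (\<sigma> v)) (\<lambda>v. X (\<sigma> v)) K"
proof -
  have inj: "inj \<sigma>" using \<sigma> bij_is_inj by blast
  have all: "(\<forall>u. P u) \<longleftrightarrow> (\<forall>u. P (\<sigma> u))" for P using \<sigma> by (metis bij_pointE)
  have card: "card (\<sigma> ` S) = card S" for S using inj by (meson card_image inj_on_subset subset_UNIV)
  have "(\<forall>v\<in>\<sigma> ` K. \<forall>u. u \<notin> \<sigma> ` K \<and> A v u \<longrightarrow> \<not> (W u \<and> X u)) \<longleftrightarrow>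
     (\<forall>v\<in>K. \<forall>u. u \<notin> K \<and> A (\<sigma> v) (\<sigma> u) \<longrightarrow> \<not> (W (\<sigma> u) \<and> X (\<sigma> u)))"
    unfolding ball_simps by (subst all) (simp add: inj_image_mem_iff[OF inj])
  then show ?thesis
    unfolding is_cell_def bdry_image_eq indecomposable_image card
    using finite_image_iff[OF inj_on_subset[OF inj subset_UNIV], of K] by simp
qed

lemma alive_image:
  "alive \<alpha> (\<lambda>u v. A (\<sigma> u) (\<sigma> v)) (\<lambda>v. V (\<sigma> v)) (\<lambda>n v. U n (\<sigma> v)) n = (\<lambda>v. alive \<alpha> A V U n (\<sigma> v))"
proof (induction n)
  case (Suc n)
  have inj: "inj \<sigma>" using \<sigma> bij_is_inj by blast
  have "(\<forall>K. is_cell \<alpha> A (alive \<alpha> A V U n) (U n) (\<sigma> ` K) \<longrightarrow> \<sigma> v \<notin> \<sigma> ` K) \<longleftrightarrow>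
    (\<forall>K. is_cell \<alpha> A (alive \<alpha> A V U n) (U n) K \<longrightarrow> \<sigma> v \<notin> K)" for v
    by (rule all_image)
  then show ?case
    unfolding alive.simps Suc.IH is_cell_image by (simp add: inj_image_mem_iff[OF inj])
qed simp

lemma cell_at_image:
  "cell_at \<alpha> (\<lambda>u v. A (\<sigma> u) (\<sigma> v)) (\<lambda>v. V (\<sigma> v)) (\<lambda>n v. U n (\<sigma> v)) n K \<longleftrightarrow> cell_at \<alpha> A V U n (\<sigma> ` K)"
  unfolding cell_at_def alive_image is_cell_image ..

lemma shut_image:
  "shut \<alpha> (\<lambda>u v. A (\<sigma> u) (\<sigma> v)) (\<lambda>v. V (\<sigma> v)) (\<lambda>n v. U n (\<sigma> v)) v \<longleftrightarrow> shut \<alpha> A V U (\<sigma> v)"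
proof -
  have "(\<exists>K. cell_at \<alpha> A V U n (\<sigma> ` K) \<and> \<sigma> v \<in> bdry A (alive \<alpha> A V U n) (\<sigma> ` K)) \<longleftrightarrow>
      (\<exists>K. cell_at \<alpha> A V U n K \<and> \<sigma> v \<in> bdry A (alive \<alpha> A V U n) K)" for n
    by (rule ex_image)
  then show ?thesis
    unfolding shut_def cell_at_image alive_image bdry_image[symmetric] by simp
qed

lemma transport_image:
  "transport \<alpha> (\<lambda>u v. A (\<sigma> u) (\<sigma> v)) (\<lambda>v. V (\<sigma> v)) (\<lambda>n v. U n (\<sigma> v)) r w = transport \<alpha> A V U (\<sigma> r) (\<sigma> w)"
proof -
  have inj: "inj \<sigma>" using \<sigma> bij_is_inj by blast
  have card: "card (\<sigma> ` S) = card S" for S using inj by (meson card_image inj_on_subset subset_UNIV)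
  have "(\<exists>K. cell_at \<alpha> A V U n (\<sigma> ` K) \<and> card (\<sigma> ` K) = k \<and> \<sigma> r \<in> \<sigma> ` K \<and>
        \<sigma> w \<in> bdry A (alive \<alpha> A V U n) (\<sigma> ` K)) \<longleftrightarrow>
      (\<exists>K. cell_at \<alpha> A V U n K \<and> card K = k \<and> \<sigma> r \<in> K \<and>
        \<sigma> w \<in> bdry A (alive \<alpha> A V U n) K)" for n k
    by (rule ex_image)
  then have "cell_bdry \<alpha> (\<lambda>u v. A (\<sigma> u) (\<sigma> v)) (\<lambda>v. V (\<sigma> v)) (\<lambda>n v. U n (\<sigma> v)) k r w \<longleftrightarrow>
      cell_bdry \<alpha> A V U k (\<sigma> r) (\<sigma> w)" for k
    unfolding cell_bdry_def cell_at_image alive_image bdry_image[symmetric]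
    by (simp add: card inj_image_mem_iff[OF inj])
  then show ?thesis unfolding transport_def by simp
qed

end

section \<open>Measurability of the construction in graph and coins\<close>

lemma pred_ex_finite:
  fixes P :: "nat set \<Rightarrow> 'a \<Rightarrow> bool"
  assumes P: "\<And>K. finite K \<Longrightarrow> Measurable.pred N (P K)"
  shows "Measurable.pred N (\<lambda>x. \<exists>K. finite K \<and> P K x)"
proof -
  \<comment> \<open>Finite sets of naturals are the sets of elements of lists, and there are only
    countably many lists.\<close>
  have "(\<exists>K. finite K \<and> P K x) \<longleftrightarrow> (\<exists>xs::nat list. P (set xs) x)" for x
    by (metis finite_list List.finite_set)
  moreover have "Measurable.pred N (\<lambda>x. \<exists>xs::nat list. P (set xs) x)"
    by (intro pred_intros_countable P) simp
  ultimately show ?thesis by simp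
qed

lemma pred_card_less:
  assumes "finite K" and P[measurable]: "\<And>v. Measurable.pred N (\<lambda>x. P x v)"
  shows "Measurable.pred N (\<lambda>x. real (card {v\<in>K. P x v}) < c)"
proof -
  have "real (card {v\<in>K. P x v}) = (\<Sum>v\<in>K. if P x v then 1 else 0)" for x
    using assms(1) by (simp add: sum.If_cases Int_def)
  then show ?thesis by simp
qed

context
  fixes N :: "'a measure" and A :: "'a \<Rightarrow> nat \<Rightarrow> nat \<Rightarrow> bool" and V :: "'a \<Rightarrow> nat \<Rightarrow> bool"
    and U :: "'a \<Rightarrow> nat \<Rightarrow> nat \<Rightarrow> bool" and \<alpha> :: real
  assumes A[measurable]: "\<And>u v. Measurable.pred N (\<lambda>x. A x u v)"
begin

lemma pred_bdry[measurable]: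
  assumes [measurable]: "\<And>v. Measurable.pred N (\<lambda>x. W x v)"
  shows "Measurable.pred N (\<lambda>x. v \<in> bdry (A x) (W x) K)"
  unfolding bdry_def mem_Collect_eq by measurable

lemma pred_is_cell:
  assumes W[measurable]: "\<And>v. Measurable.pred N (\<lambda>x. W x v)"
    and X[measurable]: "\<And>v. Measurable.pred N (\<lambda>x. X x v)"
  shows "Measurable.pred N (\<lambda>x. is_cell \<alpha> (A x) (W x) (X x) K)"
proof (cases "finite K")
  case True
  \<comment> \<open>The cuts of a finite \<open>K\<close> range over a finite power set, so the
    quantifier preserves measurability.\<close>
  have *: "indecomposable B K \<longleftrightarrow> (\<forall>S\<in>{S. S \<subseteq> K \<and> S \<noteq> {} \<and> S \<noteq> K}. \<exists>v\<in>S. \<exists>u\<in>K - S. B v u)" for B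
    unfolding indecomposable_def by blast
  have "Measurable.pred N (\<lambda>x. indecomposable (A x) K)"
    unfolding * by (rule pred_intros_finite(3)) (use True in auto)
  moreover have "Measurable.pred N (\<lambda>x. real (card (bdry (A x) (W x) K)) < \<alpha> * real (card K))"
    unfolding bdry_def by (rule pred_card_less[OF True]) measurable
  ultimately show ?thesis unfolding is_cell_def by measurable
qed (simp add: is_cell_def)

context
  assumes V[measurable]: "\<And>v. Measurable.pred N (\<lambda>x. V x v)"
    and U[measurable]: "\<And>n v. Measurable.pred N (\<lambda>x. U x n v)"
begin

lemma pred_alive[measurable]: "Measurable.pred N (\<lambda>x. alive \<alpha> (A x) (V x) (U x) n v)"
proof (induction n arbitrary: v)
  case (Suc n)
  note [measurable] = Suc
  \<comment> \<open>Cells are finite, so the quantifier over all vertex sets reduces to a countable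
    one.\<close>
  have eq: "(\<forall>K. is_cell \<alpha> (A x) W X K \<longrightarrow> v \<notin> K) \<longleftrightarrow> \<not> (\<exists>K. finite K \<and> is_cell \<alpha> (A x) W X K \<and> v \<in> K)"
    for x W X by (auto simp: is_cell_def)
  have [measurable]: "Measurable.pred N (\<lambda>x. \<exists>K. finite K \<and> is_cell \<alpha> (A x) (alive \<alpha> (A x) (V x) (U x) n) (U x n) K \<and> v \<in> K)"
    by (intro pred_ex_finite pred_intros_logic pred_is_cell) auto
  show ?case unfolding alive.simps eq by measurable
qed simp

lemma pred_cell_at[measurable]: "Measurable.pred N (\<lambda>x. cell_at \<alpha> (A x) (V x) (U x) n K)"
  unfolding cell_at_def by (intro pred_is_cell) auto

lemma pred_shut: "Measurable.pred N (\<lambda>x. shut \<alpha> (A x) (V x) (U x) v)"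
proof -
  have "shut \<alpha> (A x) (V x) (U x) v \<longleftrightarrow> (\<exists>n K. finite K \<and> cell_at \<alpha> (A x) (V x) (U x) n K \<and>
      v \<in> bdry (A x) (alive \<alpha> (A x) (V x) (U x) n) K)" for x
    unfolding shut_def using cell_at_finite by blast
  moreover have "Measurable.pred N (\<lambda>x. \<exists>n K. finite K \<and> cell_at \<alpha> (A x) (V x) (U x) n K \<and>
      v \<in> bdry (A x) (alive \<alpha> (A x) (V x) (U x) n) K)"
    by (intro pred_intros_countable pred_ex_finite) measurable
  ultimately show ?thesis by simp
qed

lemma measurable_transport: "(\<lambda>x. transport \<alpha> (A x) (V x) (U x) r w) \<in> borel_measurable N"
proof -
  have "cell_bdry \<alpha> (A x) (V x) (U x) k r w \<longleftrightarrow> (\<exists>n K. finite K \<and> cell_at \<alpha> (A x) (V x) (U x) n K \<and>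
      card K = k \<and> r \<in> K \<and> w \<in> bdry (A x) (alive \<alpha> (A x) (V x) (U x) n) K)" for x k
    unfolding cell_bdry_def using cell_at_finite by blast
  moreover have "Measurable.pred N (\<lambda>x. \<exists>n K. finite K \<and> cell_at \<alpha> (A x) (V x) (U x) n K \<and>
      card K = k \<and> r \<in> K \<and> w \<in> bdry (A x) (alive \<alpha> (A x) (V x) (U x) n) K)" for k
    by (intro pred_intros_countable pred_ex_finite) measurable
  ultimately have [measurable]: "Measurable.pred N (\<lambda>x. cell_bdry \<alpha> (A x) (V x) (U x) k r w)" for k
    by simp
  show ?thesis unfolding transport_def by measurable
qed

end

end

section \<open>Measurability on the spaces of marked and rooted graphs\<close>

lemma space_gspace[simp]: "space gspace = UNIV"
  by (simp add: gspace_def space_pair_measure space_PiM)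

lemma space_rspace[simp]: "space rspace = UNIV"
  by (simp add: rspace_def space_pair_measure)

lemma measurable_vmark[measurable (raw)]:
  assumes [measurable]: "f \<in> measurable N gspace"
  shows "(\<lambda>x. fst (f x) v) \<in> measurable N (count_space UNIV)"
proof -
  have "(\<lambda>x. fst (f x)) \<in> measurable N (PiM UNIV (\<lambda>_. count_space UNIV))"
    using assms unfolding gspace_def by measurable
  then show ?thesis by (rule measurable_compose[OF _ measurable_component_singleton]) simp
qed

lemma measurable_emark[measurable (raw)]:
  assumes [measurable]: "f \<in> measurable N gspace"
  shows "(\<lambda>x. snd (f x) u v) \<in> measurable N (count_space UNIV)"
proof -
  have "(\<lambda>x. snd (f x)) \<in> measurable N (PiM UNIV (\<lambda>_. PiM UNIV (\<lambda>_. count_space UNIV)))"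
    using assms unfolding gspace_def by measurable
  then have "(\<lambda>x. snd (f x) u) \<in> measurable N (PiM UNIV (\<lambda>_. count_space UNIV))"
    by (rule measurable_compose[OF _ measurable_component_singleton]) simp
  then show ?thesis by (rule measurable_compose[OF _ measurable_component_singleton]) simp
qed

lemma pred_vert[measurable (raw)]:
  assumes [measurable]: "f \<in> measurable N gspace"
  shows "Measurable.pred N (\<lambda>x. vert (f x) v)"
  unfolding vert_def by measurable

lemma measurable_gspaceI:
  assumes "\<And>v. (\<lambda>x. fst (f x) v) \<in> measurable N (count_space UNIV)"
    and "\<And>u v. (\<lambda>x. snd (f x) u v) \<in> measurable N (count_space UNIV)"
  shows "f \<in> measurable N gspace"
proof -
  have "(\<lambda>x. (\<lambda>v. fst (f x) v, \<lambda>u v. snd (f x) u v)) \<in> measurable N gspace"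
    unfolding gspace_def by (intro measurable_Pair measurable_abs_UNIV assms)
  then show ?thesis by simp
qed

lemma measurable_fst_rspace[measurable]: "fst \<in> measurable rspace gspace"
  and measurable_snd_rspace[measurable]: "snd \<in> measurable rspace (count_space UNIV)"
  unfolding rspace_def by simp_all

lemma measurable_rspaceI[measurable (raw)]:
  "f \<in> measurable N gspace \<Longrightarrow> g \<in> measurable N (count_space UNIV) \<Longrightarrow> (\<lambda>x. (f x, g x)) \<in> measurable N rspace"
  unfolding rspace_def by measurable

lemma measurable_fst_drspace[measurable]: "fst \<in> measurable drspace rspace"
  and measurable_snd_drspace[measurable]: "snd \<in> measurable drspace (count_space UNIV)"
  unfolding drspace_def by simp_all

lemma measurable_drspaceI[measurable (raw)]:
  "f \<in> measurable N rspace \<Longrightarrow> g \<in> measurable N (count_space UNIV) \<Longrightarrow> (\<lambda>x. (f x, g x)) \<in> measurable N drspace"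
  unfolding drspace_def by measurable

section \<open>Independent fair coins, one row per round\<close>

definition coins :: "(nat \<Rightarrow> nat \<Rightarrow> bool) measure" where
  "coins = (\<Pi>\<^sub>M n\<in>UNIV. \<Pi>\<^sub>M v\<in>UNIV. measure_pmf (bernoulli_pmf (1/2)))"

interpretation coin_row: product_prob_space "\<lambda>_::nat. measure_pmf (bernoulli_pmf (1/2))" UNIV
  by unfold_locales

interpretation coin_rows: product_prob_space
  "\<lambda>_::nat. \<Pi>\<^sub>M v\<in>(UNIV :: nat set). measure_pmf (bernoulli_pmf (1/2))" UNIV
  by unfold_locales

lemma prob_space_coins: "prob_space coins"
  unfolding coins_def by (rule coin_rows.P.prob_space_axioms)

lemma space_coins[simp]: "space coins = UNIV"
  by (simp add: coins_def space_PiM)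

lemma pred_coin[measurable (raw)]:
  assumes "f \<in> measurable N coins"
  shows "Measurable.pred N (\<lambda>x. f x n v)"
proof -
  have "(\<lambda>x. f x n) \<in> measurable N (\<Pi>\<^sub>M v\<in>UNIV. measure_pmf (bernoulli_pmf (1/2)))"
    using assms unfolding coins_def by (rule measurable_compose[OF _ measurable_component_singleton]) simp
  then have "(\<lambda>x. f x n v) \<in> measurable N (measure_pmf (bernoulli_pmf (1/2)))"
    by (rule measurable_compose[OF _ measurable_component_singleton]) simp
  then show ?thesis by (simp cong: measurable_cong_sets)
qed

lemma measurable_coinsI:
  assumes "\<And>n v. Measurable.pred N (\<lambda>x. f x n v)"
  shows "f \<in> measurable N coins"
proof -
  have "(\<lambda>x n v. f x n v) \<in> measurable N coins"
    unfolding coins_def using assms by (intro measurable_abs_UNIV) (simp cong: measurable_cong_sets)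
  then show ?thesis by simp
qed

text \<open>Relabelling permutes identical independent factors inside each row and leaves the rows
  in place. The row case is a reindexing of a product measure; the rows are then combined by
  comparing cylinder sets.\<close>

lemma coins_relabel:
  assumes "bij \<sigma>"
  shows "distr coins coins (\<lambda>U n v. U n (\<sigma> v)) = coins"
proof -
  let ?Q = "\<Pi>\<^sub>M v\<in>(UNIV :: nat set). measure_pmf (bernoulli_pmf (1/2))"
  have row: "distr ?Q ?Q (\<lambda>X v. X (\<sigma> v)) = ?Q"
    using distr_PiM_reindex[of UNIV "\<lambda>_. measure_pmf (bernoulli_pmf (1/2))" \<sigma> UNIV] assms
    by (simp add: bij_is_inj restrict_UNIV prob_space_measure_pmf)
  have [measurable]: "(\<lambda>X v. X (\<sigma> v)) \<in> measurable ?Q ?Q"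
    by (intro measurable_abs_UNIV measurable_component_singleton) simp
  have [measurable]: "(\<lambda>U n v. U n (\<sigma> v)) \<in> measurable coins coins"
    by (intro measurable_coinsI) measurable
  show ?thesis
    unfolding coins_def
  proof (rule coin_rows.PiM_eq)
    fix J :: "nat set" and F assume J: "finite J" "J \<subseteq> UNIV" and F: "\<And>j. j \<in> J \<Longrightarrow> F j \<in> sets ?Q"
    let ?P = "\<Pi>\<^sub>M n\<in>(UNIV :: nat set). ?Q" and ?s = "\<lambda>X v. X (\<sigma> v)"
    have F': "?s -` F j \<in> sets ?Q" if "j \<in> J" for j
      using measurable_sets[of ?s ?Q ?Q "F j"] F[OF that] by (simp add: space_PiM)
    have "emeasure (distr ?P ?P (\<lambda>U n v. U n (\<sigma> v))) (prod_emb UNIV (\<lambda>_. ?Q) J (Pi\<^sub>E J F)) =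
       emeasure ?P ((\<lambda>U n v. U n (\<sigma> v)) -` prod_emb UNIV (\<lambda>_. ?Q) J (Pi\<^sub>E J F) \<inter> space ?P)"
      using J F \<open>(\<lambda>U n v. U n (\<sigma> v)) \<in> measurable coins coins\<close>
      by (intro emeasure_distr) (auto simp: coins_def intro!: sets_PiM_I)
    \<comment> \<open>As the map acts on each row separately, the preimage of a cylinder is the
      cylinder over the preimages of its sides.\<close>
    also have "(\<lambda>U n v. U n (\<sigma> v)) -` prod_emb UNIV (\<lambda>_. ?Q) J (Pi\<^sub>E J F) \<inter> space ?P =
       prod_emb UNIV (\<lambda>_. ?Q) J (Pi\<^sub>E J (\<lambda>j. ?s -` F j))"
      by (auto simp: prod_emb_def space_PiM PiE_iff)
    also have "emeasure ?P \<dots> = (\<Prod>j\<in>J. emeasure ?Q (?s -` F j))"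
      using J F' by (intro coin_rows.emeasure_PiM_emb) auto
    also have "\<dots> = (\<Prod>j\<in>J. emeasure ?Q (F j))"
    proof (intro prod.cong refl)
      fix j assume "j \<in> J"
      then show "emeasure ?Q (?s -` F j) = emeasure ?Q (F j)"
        using emeasure_distr[of ?s ?Q ?Q "F j"] F row by (simp add: space_PiM)
    qed
    finally show "emeasure (distr ?P ?P (\<lambda>U n v. U n (\<sigma> v))) (prod_emb UNIV (\<lambda>_. ?Q) J (Pi\<^sub>E J F)) =
      (\<Prod>j\<in>J. emeasure ?Q (F j))" .
  qed simp
qed

text \<open>A fixed pattern has positive probability in one row, and the rows are independent. So
  the probability that it is missed in \<open>k\<close> consecutive rows is \<open>q ^ k\<close>
  with \<open>q < 1\<close>, which tends to 0.\<close>

lemma AE_seen_io: "AE U in coins. seen_io U"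
proof -
  let ?B = "measure_pmf (bernoulli_pmf (1/2))"
  let ?Q = "\<Pi>\<^sub>M v\<in>(UNIV :: nat set). ?B"
  have *: "AE U in coins. \<exists>n\<ge>N. (\<forall>v\<in>S. U n v) \<and> (\<forall>v\<in>T. \<not> U n v)"
    if ST: "finite S" "finite T" "S \<inter> T = {}" for S T :: "nat set" and N
  proof -
    \<comment> \<open>The pattern is written coordinate by coordinate, in the form for which the
      product measure gives a finite product of positive factors.\<close>
    define E where "E = {X \<in> space ?Q. \<forall>v\<in>S \<union> T. X v \<in> (if v \<in> S then {True} else {False})}"
    have E: "E = {X. (\<forall>v\<in>S. X v) \<and> (\<forall>v\<in>T. \<not> X v)}"
      using ST by (auto simp: E_def space_PiM)
    have "Measurable.pred ?Q (\<lambda>X. X v)" for v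
      using measurable_component_singleton[of v UNIV "\<lambda>_. ?B"] by (simp cong: measurable_cong_sets)
    then have "Measurable.pred ?Q (\<lambda>X. (\<forall>v\<in>S. X v) \<and> (\<forall>v\<in>T. \<not> X v))"
      using ST by (intro pred_intros_logic pred_intros_finite) auto
    then have Es: "E \<in> sets ?Q" by (simp add: E pred_def space_PiM)
    have "emeasure ?Q E = (\<Prod>v\<in>S \<union> T. emeasure ?B (if v \<in> S then {True} else {False}))"
      unfolding E_def using ST by (intro coin_row.emeasure_PiM_Collect) auto
    also have "\<dots> > 0"
      by (auto simp: zero_less_iff_neq_zero prod_zero_iff ST emeasure_pmf_single)
    finally have pos: "measure ?Q E > 0"
      by (simp add: coin_row.P.emeasure_eq_measure)
    define q where "q = measure ?Q (- E)"
    have q1: "q < 1" "0 \<le> q"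
      using pos coin_row.P.prob_compl[OF Es] by (auto simp: q_def space_PiM Compl_eq_Diff_UNIV)
    have cE: "- E \<in> sets ?Q" using sets.compl_sets[OF Es] by (simp add: space_PiM Compl_eq_Diff_UNIV)
    define Z where "Z = {U. \<forall>n\<ge>N. U n \<notin> E}"
    have Zs: "Z \<in> sets coins"
    proof -
      have "Measurable.pred coins (\<lambda>U. \<forall>n\<ge>N. \<not> ((\<forall>v\<in>S. U n v) \<and> (\<forall>v\<in>T. \<not> U n v)))"
        using ST by measurable
      then show ?thesis by (simp add: Z_def E pred_def)
    qed
    have "emeasure coins Z \<le> ennreal (q ^ k)" for k
    proof -
      have "Measurable.pred coins (\<lambda>U. \<forall>n\<in>{N..<N+k}. \<not> ((\<forall>v\<in>S. U n v) \<and> (\<forall>v\<in>T. \<not> U n v)))"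
        using ST by measurable
      then have "{U \<in> space coins. \<forall>n\<in>{N..<N+k}. U n \<in> - E} \<in> sets coins"
        by (simp add: E pred_def)
      then have "emeasure coins Z \<le> emeasure coins {U \<in> space coins. \<forall>n\<in>{N..<N+k}. U n \<in> - E}"
        by (intro emeasure_mono) (auto simp: Z_def)
      also have "\<dots> = (\<Prod>n\<in>{N..<N+k}. emeasure ?Q (- E))"
        unfolding coins_def using cE by (intro coin_rows.emeasure_PiM_Collect) auto
      also have "\<dots> = ennreal (q ^ k)"
        using q1 by (simp add: coin_row.P.emeasure_eq_measure q_def ennreal_power)
      finally show ?thesis .
    qed
    moreover have "(\<lambda>k. ennreal (q ^ k)) \<longlonglongrightarrow> ennreal 0"
      using q1 by (intro tendsto_ennrealI LIMSEQ_power_zero) auto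
    ultimately have "emeasure coins Z \<le> 0"
      by (intro LIMSEQ_le_const[where X = "\<lambda>k. ennreal (q ^ k)"]) auto
    then have "Z \<in> null_sets coins" using Zs by (intro null_setsI) auto
    then show ?thesis by (rule AE_I') (auto simp: Z_def E)
  qed
  \<comment> \<open>There are only countably many triples of two finite sets and a starting round,
    so the exceptional null sets can be united.\<close>
  have "AE U in coins. \<forall>p\<in>Collect finite \<times> Collect finite \<times> UNIV. case p of (S, T, N) \<Rightarrow>
     S \<inter> T = {} \<longrightarrow> (\<exists>n\<ge>N. (\<forall>v\<in>S. U n v) \<and> (\<forall>v\<in>T. \<not> U n v))"
  proof (rule AE_ball_countable')
    show "countable (Collect finite \<times> Collect finite \<times> (UNIV :: nat set) :: (nat set \<times> nat set \<times> nat) set)"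
      by (intro countable_SIGMA countable_Collect_finite countableI_type)
  qed (use * in auto)
  then show ?thesis
    by (rule AE_mp) (auto simp: seen_io_def)
qed

section \<open>Mass transport on a unimodular graph with additional coins\<close>

lemma relabel_simps[simp]:
  "fst (relabel \<pi> G) v = fst G (inv \<pi> v)" "snd (relabel \<pi> G) u v = snd G (inv \<pi> u) (inv \<pi> v)"
  by (auto simp: relabel_def)

text \<open>Integrating out the coins turns \<open>h\<close> into a transport function of the graph
  alone. It is invariant because relabelling graph and coins together does not change
  \<open>h\<close>, and relabelled coins have the same law.\<close>

lemma mass_transport_coins:
  fixes M :: "(('v, 'e) mgraph \<times> nat) measure"
    and h :: "('v, 'e) mgraph \<Rightarrow> (nat \<Rightarrow> nat \<Rightarrow> bool) \<Rightarrow> nat \<Rightarrow> nat \<Rightarrow> ennreal"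
  assumes M: "unimodular M"
    and h: "(\<lambda>p. h (fst (fst (fst p))) (snd p) (snd (fst (fst p))) (snd (fst p)))
      \<in> borel_measurable (drspace \<Otimes>\<^sub>M coins)"
    and inv: "\<And>\<pi> G U r w. bij \<pi> \<Longrightarrow>
      h (relabel \<pi> G) (\<lambda>n v. U n (inv \<pi> v)) (\<pi> r) (\<pi> w) = h G U r w"
  shows "(\<integral>\<^sup>+x. \<integral>\<^sup>+U. (\<Sum>w. if vert (fst x) w then h (fst x) U (snd x) w else 0) \<partial>coins \<partial>M) =
    (\<integral>\<^sup>+x. \<integral>\<^sup>+U. (\<Sum>w. if vert (fst x) w then h (fst x) U w (snd x) else 0) \<partial>coins \<partial>M)"
proof -
  interpret C: prob_space coins by (rule prob_space_coins)
  define F where "F y = (\<integral>\<^sup>+U. h (fst (fst y)) U (snd (fst y)) (snd y) \<partial>coins)" for y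
  have sec: "(\<lambda>U. h G U r w) \<in> borel_measurable coins" for G r w
  proof -
    have "((G, r), w) \<in> space drspace"
      by (simp add: drspace_def space_pair_measure)
    from measurable_Pair_compose_split[of "\<lambda>y U. h (fst (fst y)) U (snd (fst y)) (snd y)" drspace coins borel,
      OF _ measurable_const[OF this] measurable_ident]
    show ?thesis using h by (simp add: split_beta')
  qed
  have F: "F \<in> borel_measurable drspace"
    unfolding F_def using C.borel_measurable_nn_integral[of
      "\<lambda>y U. h (fst (fst y)) U (snd (fst y)) (snd y)" drspace] h by (simp add: split_beta')
  have "F ((relabel \<pi> G, \<pi> r), \<pi> w) = F ((G, r), w)" if \<pi>: "bij \<pi>" for \<pi> G r w
  proof -
    have meas: "(\<lambda>U n v. U n (inv \<pi> v)) \<in> measurable coins coins"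
      by (rule measurable_coinsI) measurable
    have "F ((relabel \<pi> G, \<pi> r), \<pi> w) =
        (\<integral>\<^sup>+U. h (relabel \<pi> G) U (\<pi> r) (\<pi> w) \<partial>distr coins coins (\<lambda>U n v. U n (inv \<pi> v)))"
      unfolding F_def coins_relabel[OF bij_imp_bij_inv[OF \<pi>]] by simp
    also have "\<dots> = (\<integral>\<^sup>+U. h G U r w \<partial>coins)"
      by (subst nn_integral_distr[OF meas]) (simp_all add: inv[OF \<pi>] sec)
    finally show ?thesis by (simp add: F_def)
  qed
  then have "invariant2 F" unfolding invariant2_def by blast
  with M F have "(\<integral>\<^sup>+ x. (\<Sum>w. if vert (fst x) w then F ((fst x, snd x), w) else 0) \<partial>M) =
        (\<integral>\<^sup>+ x. (\<Sum>w. if vert (fst x) w then F ((fst x, w), snd x) else 0) \<partial>M)"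
    unfolding unimodular_def by blast
  \<comment> \<open>The index functions \<open>f\<close> and \<open>g\<close> let one computation
    cover both the mass sent and the mass received by the root.\<close>
  moreover have "(\<integral>\<^sup>+U. (\<Sum>w. if vert G w then h G U (f w) (g w) else 0) \<partial>coins) =
      (\<Sum>w. if vert G w then F ((G, f w), g w) else 0)" for G and f g :: "nat \<Rightarrow> nat"
  proof -
    have "(\<integral>\<^sup>+U. (\<Sum>w. if vert G w then h G U (f w) (g w) else 0) \<partial>coins) =
      (\<Sum>w. \<integral>\<^sup>+U. (if vert G w then h G U (f w) (g w) else 0) \<partial>coins)"
      using sec by (intro nn_integral_suminf) simp
    also have "\<dots> = (\<Sum>w. if vert G w then F ((G, f w), g w) else 0)"
      by (intro suminf_cong) (simp add: F_def)
    finally show ?thesis .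
  qed
  note this[of _ "\<lambda>_. r" "\<lambda>w. w" for r] this[of _ "\<lambda>w. w" "\<lambda>_. r" for r]
  ultimately show ?thesis by simp
qed

section \<open>The site percolation defined by the shut vertices\<close>

definition open_edge :: "(bool, bool) mgraph \<Rightarrow> nat \<Rightarrow> nat \<Rightarrow> bool" where
  "open_edge G u v \<longleftrightarrow> snd G u v = Some True"

definition open_vert :: "(bool, bool) mgraph \<Rightarrow> nat \<Rightarrow> bool" where
  "open_vert G v \<longleftrightarrow> fst G v = Some True"

definition mark :: "(nat \<Rightarrow> bool) \<Rightarrow> (bool, bool) mgraph \<Rightarrow> (bool \<times> bool, bool \<times> bool) mgraph" where
  "mark S G = (\<lambda>v. map_option (\<lambda>b. (b, S v)) (fst G v), \<lambda>u v. map_option (\<lambda>b. (b, S u \<and> S v)) (snd G u v))"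

text \<open>Shut vertices lie in cells and hence are open for the given percolation. A vertex closed
  there is therefore open in the new marking and adds nothing to the rate.\<close>

definition perc :: "real \<Rightarrow> (bool, bool) mgraph \<Rightarrow> (nat \<Rightarrow> nat \<Rightarrow> bool) \<Rightarrow> (bool \<times> bool, bool \<times> bool) mgraph" where
  "perc \<alpha> G U = mark (\<lambda>v. \<not> shut \<alpha> (open_edge G) (open_vert G) U v) G"

lemma forget_mark[simp]: "forget (mark S G) = G"
  by (auto simp: forget_def mark_def option.map_comp comp_def option.map_ident)

lemma vert_mark[simp]: "vert (mark S G) v \<longleftrightarrow> vert G v"
  by (simp add: vert_def mark_def)

lemma vert_perc[simp]: "vert (perc \<alpha> G U) v \<longleftrightarrow> vert G v"
  by (simp add: perc_def)

lemma site_perc_mark: "(\<And>u v. adj G u v \<Longrightarrow> vert G u \<and> vert G v) \<Longrightarrow> site_perc_snd (mark S G)"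
  by (fastforce simp: site_perc_snd_def mark_def adj_def vert_def)

lemma sub_vert_mark: "sub_vert (mark S G) v \<longleftrightarrow> open_vert G v \<and> S v"
  by (auto simp: sub_vert_def mark_def open_vert_def)

lemma sub_adj_mark: "sub_adj (mark S G) u v \<longleftrightarrow> open_edge G u v \<and> S u \<and> S v"
  by (auto simp: sub_adj_def mark_def open_edge_def)

lemma open_relabel:
  "open_edge (relabel \<pi> G) = (\<lambda>u v. open_edge G (inv \<pi> u) (inv \<pi> v))"
  "open_vert (relabel \<pi> G) = (\<lambda>v. open_vert G (inv \<pi> v))"
  by (auto simp: fun_eq_iff open_edge_def open_vert_def)

lemma perc_relabel:
  assumes "bij \<pi>"
  shows "perc \<alpha> (relabel \<pi> G) (\<lambda>n v. U n (inv \<pi> v)) = relabel \<pi> (perc \<alpha> G U)"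
  unfolding perc_def open_relabel shut_image[OF bij_imp_bij_inv[OF assms]]
  by (simp add: mark_def relabel_def)

lemma pred_open_edge[measurable (raw)]:
  assumes [measurable]: "f \<in> measurable N gspace"
  shows "Measurable.pred N (\<lambda>x. open_edge (f x) u v)"
  unfolding open_edge_def by measurable

lemma pred_open_vert[measurable (raw)]:
  assumes [measurable]: "f \<in> measurable N gspace"
  shows "Measurable.pred N (\<lambda>x. open_vert (f x) v)"
  unfolding open_vert_def by measurable

lemma pred_shut_open:
  assumes [measurable]: "f \<in> measurable N gspace" "g \<in> measurable N coins"
  shows "Measurable.pred N (\<lambda>x. shut \<alpha> (open_edge (f x)) (open_vert (f x)) (g x) v)"
  by (intro pred_shut) measurable

text \<open>Here the two endpoints vary with the sample point. They take countably many values, so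
  the case of fixed endpoints suffices.\<close>

lemma measurable_transport_open:
  assumes [measurable]: "f \<in> measurable N gspace" "g \<in> measurable N coins"
    "r \<in> measurable N (count_space UNIV)" "w \<in> measurable N (count_space UNIV)"
  shows "(\<lambda>x. transport \<alpha> (open_edge (f x)) (open_vert (f x)) (g x) (r x) (w x)) \<in> borel_measurable N"
proof -
  let ?t = "\<lambda>a b x. transport \<alpha> (open_edge (f x)) (open_vert (f x)) (g x) a b"
  have "?t a b \<in> borel_measurable N" for a b
    by (intro measurable_transport) measurable
  then have "(\<lambda>x. ?t a (w x) x) \<in> borel_measurable N" for a
    by (rule measurable_compose_countable[where f = "?t a" and g = w]) (rule assms)
  then show ?thesis
    by (rule measurable_compose_countable[where f = "\<lambda>a x. ?t a (w x) x" and g = r]) (rule assms)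
qed

lemma measurable_perc:
  assumes [measurable]: "f \<in> measurable N gspace" "g \<in> measurable N coins"
  shows "(\<lambda>x. perc \<alpha> (f x) (g x)) \<in> measurable N gspace"
proof (rule measurable_gspaceI)
  note [measurable] = pred_shut_open[OF assms, of \<alpha>]
  show "(\<lambda>x. fst (perc \<alpha> (f x) (g x)) v) \<in> measurable N (count_space UNIV)" for v
    unfolding perc_def mark_def fst_conv
    by (rule measurable_compose_countable[where g = "\<lambda>x. fst (f x) v"]) measurable
  show "(\<lambda>x. snd (perc \<alpha> (f x) (g x)) u v) \<in> measurable N (count_space UNIV)" for u v
    unfolding perc_def mark_def snd_conv
    by (rule measurable_compose_countable[where g = "\<lambda>x. snd (f x) u v"]) measurable
qed

lemma measurable_forget[measurable (raw)]:
  fixes f :: "'a \<Rightarrow> ('v \<times> 'w, 'e \<times> 'd) mgraph"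
  assumes [measurable]: "f \<in> measurable N gspace"
  shows "(\<lambda>x. forget (f x)) \<in> measurable N gspace"
proof (rule measurable_gspaceI)
  show "(\<lambda>x. fst (forget (f x)) v) \<in> measurable N (count_space UNIV)" for v
    unfolding forget_def fst_conv by (rule measurable_compose[OF measurable_vmark[OF assms]]) simp
  show "(\<lambda>x. snd (forget (f x)) u v) \<in> measurable N (count_space UNIV)" for u v
    unfolding forget_def snd_conv by (rule measurable_compose[OF measurable_emark[OF assms]]) simp
qed

section \<open>From trapped finite sets to the expansion of infinite components\<close>

text \<open>A countable condition that implies the expansion bound for infinite components without
  mentioning connectivity, so that it is visibly measurable.\<close>
definition expanding_or_trapped :: "real \<Rightarrow> (bool \<times> bool, bool \<times> bool) mgraph \<Rightarrow> bool" where
  "expanding_or_trapped \<alpha> G \<longleftrightarrow> \<not> (\<exists>K. finite K \<and>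
     (K \<noteq> {} \<and> (\<forall>v\<in>K. sub_vert G v) \<and> real (card (bdry (sub_adj G) (\<lambda>_. True) K)) < \<alpha> * real (card K) \<and>
     \<not> (\<exists>L. finite L \<and> (K \<inter> L \<noteq> {} \<and> (\<forall>v\<in>L. \<forall>u. sub_adj G v u \<longrightarrow> u \<in> L)))))"

lemma pred_expanding_or_trapped:
  assumes [measurable]: "f \<in> measurable N gspace"
  shows "Measurable.pred N (\<lambda>x. expanding_or_trapped \<alpha> (f x))"
proof -
  have [measurable]: "Measurable.pred N (\<lambda>x. sub_vert (f x) v)" "Measurable.pred N (\<lambda>x. sub_adj (f x) u v)" for u v
    unfolding sub_vert_def sub_adj_def by measurable
  have 1: "Measurable.pred N (\<lambda>x. real (card (bdry (sub_adj (f x)) (\<lambda>_. True) K)) < \<alpha> * real (card K))"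
    if "finite K" for K
    unfolding bdry_def by (rule pred_card_less[OF that]) measurable
  show ?thesis unfolding expanding_or_trapped_def
    by (intro pred_intros_logic(2) pred_ex_finite pred_intros_logic 1) measurable
qed

text \<open>A violating finite subset of \<open>C\<close> would meet a finite set \<open>L\<close>
  closed under adjacency. By connectedness \<open>L\<close> would contain all of \<open>C\<close>,
  which is infinite.\<close>

lemma inner_expansion_ge:
  assumes Q: "expanding_or_trapped \<alpha> G" and sym: "symp (sub_adj G)"
    and end_vert: "\<And>u v. sub_adj G u v \<Longrightarrow> sub_vert G v"
    and C: "C \<in> components (sub_vert G) (sub_adj G)" "infinite C"
  shows "inner_expansion (sub_adj G) C \<ge> \<alpha>"
proof -
  obtain v where v: "sub_vert G v" and C_def: "C = {u. (sub_adj G)\<^sup>*\<^sup>* v u}"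
    using C(1) unfolding components_def by auto
  have Cv: "sub_vert G u" if "u \<in> C" for u
  proof -
    have "(sub_adj G)\<^sup>*\<^sup>* v u" using that C_def by simp
    then show ?thesis by (induction) (auto intro: v end_vert)
  qed
  have "\<alpha> \<le> real (card (inner_boundary (sub_adj G) C K)) / real (card K)"
    if K: "K \<noteq> {}" "K \<subseteq> C" "finite K" for K
  proof (rule ccontr)
    assume small: "\<not> ?thesis"
    have "inner_boundary (sub_adj G) C K = bdry (sub_adj G) (\<lambda>_. True) K"
      using K(2) unfolding inner_boundary_def bdry_def C_def
      by (auto intro: rtranclp.rtrancl_into_rtrancl)
    moreover have "card K > 0" using K card_gt_0_iff by blast
    ultimately have "real (card (bdry (sub_adj G) (\<lambda>_. True) K)) < \<alpha> * real (card K)"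
      using small by (simp add: field_simps)
    moreover have "\<forall>v\<in>K. sub_vert G v" using K Cv by auto
    ultimately obtain L where L: "finite L" "K \<inter> L \<noteq> {}" "\<And>v u. v \<in> L \<Longrightarrow> sub_adj G v u \<Longrightarrow> u \<in> L"
      using Q K unfolding expanding_or_trapped_def by meson
    have closed: "u \<in> L" if "(sub_adj G)\<^sup>*\<^sup>* w u" "w \<in> L" for w u
      using that by (induction) (auto intro: L(3))
    obtain w where w: "w \<in> L" "w \<in> C" using L K by auto
    have "(sub_adj G)\<^sup>*\<^sup>* w v"
      using w sym C_def by (simp add: symp_rtranclp sympD)
    then have "v \<in> L" using closed w by blast
    then have "C \<subseteq> L" using closed C_def by auto
    then show False using C L finite_subset by blast
  qed
  \<comment> \<open>The singleton shows that the infimum is over a nonempty set, as the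
    greatest-lower-bound property of the reals requires.\<close>
  moreover have "{v} \<subseteq> C" using C_def by auto
  ultimately show ?thesis
    unfolding inner_expansion_def by (intro cInf_greatest) (auto intro!: exI[of _ "{v}"])
qed

lemma perc_expanding_or_trapped:
  assumes wf: "wf_rooted (G, r)" and p: "is_percolation_marks G" and U: "seen_io U"
  shows "expanding_or_trapped \<alpha> (perc \<alpha> G U)"
proof -
  let ?A = "open_edge G" and ?V = "open_vert G"
  let ?S = "\<lambda>v. \<not> shut \<alpha> ?A ?V U v"
  have sym: "symp ?A" using wf unfolding wf_rooted_def Let_def open_edge_def by (auto intro!: sympI)
  have AV: "\<forall>u v. ?A u v \<longrightarrow> ?V u" using p unfolding is_percolation_marks_def open_edge_def open_vert_def by blast
  have lf: "finite {u. ?A v u}" for v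
  proof (rule finite_subset)
    show "finite {u. adj G v u}" using wf unfolding wf_rooted_def Let_def by simp
  qed (auto simp: open_edge_def adj_def)
  have "\<exists>L. finite L \<and> (K \<inter> L \<noteq> {} \<and> (\<forall>v\<in>L. \<forall>u. sub_adj (perc \<alpha> G U) v u \<longrightarrow> u \<in> L))"
    if K: "finite K" "K \<noteq> {}" "\<forall>v\<in>K. sub_vert (perc \<alpha> G U) v"
      and small: "real (card (bdry (sub_adj (perc \<alpha> G U)) (\<lambda>_. True) K)) < \<alpha> * real (card K)" for K
  proof -
    have KV: "\<And>v. v \<in> K \<Longrightarrow> ?V v \<and> ?S v" using K(3) by (simp add: perc_def sub_vert_mark)
    \<comment> \<open>As \<open>K\<close> consists of unshut vertices, an open edge out of
      \<open>K\<close> survives exactly when its other end is unshut.\<close>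
    have eq: "bdry (sub_adj (perc \<alpha> G U)) (\<lambda>_. True) K = bdry ?A ?S K"
      using KV unfolding bdry_def perc_def sub_adj_mark by blast
    obtain L where "finite L" "K \<inter> L \<noteq> {}" "\<forall>v\<in>L. \<forall>u. ?A v u \<longrightarrow> ?S v \<longrightarrow> ?S u \<longrightarrow> u \<in> L"
      using expansion_or_trapped[OF sym AV lf U K(1,2) KV small[unfolded eq]] by blast
    then show ?thesis by (intro exI[of _ L]) (auto simp: perc_def sub_adj_mark)
  qed
  then show ?thesis unfolding expanding_or_trapped_def by blast
qed

section \<open>The law of the percolated graph: unimodularity, expansion and rate\<close>

theorem theorem4p1:
  fixes M :: "((bool, bool) mgraph \<times> nat) measure" and D :: nat
  assumes "unimodular M"
    and "AE x in M. is_percolation_marks (fst x)"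
    and "D > 0"
    and "AE x in M. \<forall>v. fst (fst x) v = Some True \<longrightarrow>
                       card {u. snd (fst x) v u = Some True} \<le> D"
  shows "\<forall>\<alpha>::real. \<alpha> > 0 \<longrightarrow>
    (\<exists>M' :: ((bool \<times> bool, bool \<times> bool) mgraph \<times> nat) measure.
       unimodular M' \<and>
       (\<forall>g \<in> borel_measurable rspace. invariant1 g \<longrightarrow>
          (\<integral>\<^sup>+ x. g (forget (fst x), snd x) \<partial>M') = (\<integral>\<^sup>+ x. g x \<partial>M)) \<and>
       (AE x in M'. site_perc_snd (fst x)) \<and>
       measure M' {x \<in> space M'. map_option snd (fst (fst x) (snd x)) \<noteq> Some True} \<le> \<alpha> \<and>
       (AE x in M'. \<forall>C \<in> components (sub_vert (fst x)) (sub_adj (fst x)).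
          infinite C \<longrightarrow> inner_expansion (sub_adj (fst x)) C \<ge> \<alpha>))"
proof (intro allI impI)
  fix \<alpha> :: real assume \<alpha>: "\<alpha> > 0"
  interpret C: prob_space coins by (rule prob_space_coins)
  interpret M: prob_space M using assms(1) unfolding unimodular_def by blast
  interpret MC: pair_prob_space M coins ..
  have sM[measurable_cong]: "sets M = sets rspace" and wfM: "AE x in M. wf_rooted x"
    using assms(1) unfolding unimodular_def by auto
  have spM: "space M = UNIV" using sets_eq_imp_space_eq[OF sM] by simp
  define \<Phi> where "\<Phi> p = (perc \<alpha> (fst (fst p)) (snd p), snd (fst p))"
    for p :: "((bool, bool) mgraph \<times> nat) \<times> (nat \<Rightarrow> nat \<Rightarrow> bool)"
  have fst_\<Phi>: "fst (\<Phi> p) = perc \<alpha> (fst (fst p)) (snd p)" for p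
    by (simp add: \<Phi>_def)
  have \<Phi>[measurable]: "\<Phi> \<in> measurable (M \<Otimes>\<^sub>M coins) rspace"
    unfolding \<Phi>_def by (intro measurable_rspaceI measurable_perc) measurable
  define M' where "M' = distr (M \<Otimes>\<^sub>M coins) rspace \<Phi>"
  have sM'[measurable_cong]: "sets M' = sets rspace" and spM': "space M' = UNIV"
    by (simp_all add: M'_def)
  interpret M': prob_space M' unfolding M'_def by (rule MC.prob_space_distr[OF \<Phi>])

  define fg where "fg x = (forget (fst x), snd x)" for x :: "(bool \<times> bool, bool \<times> bool) mgraph \<times> nat"
  have fg[measurable]: "fg \<in> measurable rspace rspace"
    unfolding fg_def by measurable
  have fg\<Phi>: "fg (\<Phi> p) = fst p" for p
    by (simp add: fg_def \<Phi>_def perc_def)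
  \<comment> \<open>Forgetting the new marks recovers \<open>M\<close> as a measure on labelled
    graphs, not just up to isomorphism. This yields the marginal condition and carries almost sure
    properties of the base graph over to \<open>M'\<close>.\<close>
  have M_eq: "M = distr M' M fg"
  proof -
    have "distr M' M fg = distr (M \<Otimes>\<^sub>M coins) M (\<lambda>p. fg (\<Phi> p))"
      unfolding M'_def by (subst distr_distr) (auto simp: comp_def)
    then show ?thesis by (simp add: fg\<Phi> C.distr_pair_fst)
  qed
  \<comment> \<open>This transfer is valid for an arbitrary predicate, in particular for
    \<open>wf_rooted\<close>, which involves reachability. Properties of the new marks go through
    \<open>AE_M'I\<close>, where measurability is supplied.\<close>
  have AE_forget: "AE x in M'. P (fg x)" if "AE x in M. P x" for P
  proof (rule AE_distrD[of fg M' M])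
    show "AE x in distr M' M fg. P x" using that unfolding M_eq[symmetric] .
  qed measurable
  have AE_M'I: "AE x in M'. P x" if P: "Measurable.pred rspace P" and ae: "AE x in M. AE U in coins. P (\<Phi> (x, U))" for P
  proof -
    have "{p \<in> space (M \<Otimes>\<^sub>M coins). P (\<Phi> (fst p, snd p))} \<in> sets (M \<Otimes>\<^sub>M coins)"
      using measurable_compose[OF \<Phi> P] by (simp add: pred_def)
    then have "AE p in M \<Otimes>\<^sub>M coins. P (\<Phi> (fst p, snd p))"
      using MC.AE_pair_iff[of "\<lambda>x U. P (\<Phi> (x, U))"] ae by simp
    then show ?thesis
      unfolding M'_def using P by (subst AE_distr_iff[OF \<Phi>]) (auto simp: pred_def)
  qed
  have nn_M': "(\<integral>\<^sup>+x. f x \<partial>M') = (\<integral>\<^sup>+x. \<integral>\<^sup>+U. f (\<Phi> (x, U)) \<partial>coins \<partial>M)"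
    if f[measurable]: "f \<in> borel_measurable rspace" for f
    unfolding M'_def by (simp add: nn_integral_distr C.nn_integral_fst[symmetric])

  have wf': "AE x in M'. wf_rooted (fg x)" by (rule AE_forget[OF wfM])
  have perc': "AE x in M'. is_percolation_marks (fst (fg x))"
    by (rule AE_forget[OF assms(2)])
  \<comment> \<open>Symmetry of the edge marks is the one part of \<open>wf_rooted\<close> that the
    forgotten graph does not determine.\<close>
  have sym': "AE x in M'. \<forall>u v. snd (fst x) u v = snd (fst x) v u"
  proof (rule AE_M'I)
    show "Measurable.pred rspace (\<lambda>x :: (bool \<times> bool, bool \<times> bool) mgraph \<times> nat.
      \<forall>u v. snd (fst x) u v = snd (fst x) v u)" by measurable
    show "AE x in M. AE U in coins. \<forall>u v. snd (fst (\<Phi> (x, U))) u v = snd (fst (\<Phi> (x, U))) v u"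
      using wfM
    proof eventually_elim
      case (elim x)
      then show ?case
        by (auto simp: fst_\<Phi> perc_def mark_def wf_rooted_def Let_def conj_commute)
    qed
  qed
  have wf: "AE x in M'. wf_rooted x"
    using wf' sym'
  proof eventually_elim
    case (elim x)
    have "adj (fst (fg x)) = adj (fst x)" "vert (fst (fg x)) = vert (fst x)"
      by (auto simp: fun_eq_iff fg_def forget_def adj_def vert_def)
    then show ?case using elim by (simp add: wf_rooted_def Let_def) (simp add: fg_def)
  qed
  have site: "AE x in M'. site_perc_snd (fst x)"
  proof (rule AE_M'I)
    show "Measurable.pred rspace (\<lambda>x :: (bool \<times> bool, bool \<times> bool) mgraph \<times> nat. site_perc_snd (fst x))"
      unfolding site_perc_snd_def by measurable
    show "AE x in M. AE U in coins. site_perc_snd (fst (\<Phi> (x, U)))"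
      using wfM
    proof eventually_elim
      case (elim x)
      then show ?case unfolding fst_\<Phi> perc_def
        by (intro AE_I2 site_perc_mark) (auto simp: wf_rooted_def Let_def)
    qed
  qed
  have expanding: "AE x in M'. expanding_or_trapped \<alpha> (fst x)"
  proof (rule AE_M'I)
    show "Measurable.pred rspace (\<lambda>x. expanding_or_trapped \<alpha> (fst x))"
      by (rule pred_expanding_or_trapped) measurable
    show "AE x in M. AE U in coins. expanding_or_trapped \<alpha> (fst (\<Phi> (x, U)))"
      using wfM assms(2)
    proof eventually_elim
      case (elim x)
      show ?case using AE_seen_io
      proof eventually_elim
        case (elim U)
        then show ?case using perc_expanding_or_trapped[of "fst x" "snd x" U \<alpha>]
          \<open>wf_rooted x\<close> \<open>is_percolation_marks (fst x)\<close> by (simp add: fst_\<Phi>)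
      qed
    qed
  qed
  have comps: "AE x in M'. \<forall>C \<in> components (sub_vert (fst x)) (sub_adj (fst x)).
          infinite C \<longrightarrow> inner_expansion (sub_adj (fst x)) C \<ge> \<alpha>"
    using expanding wf perc' site
  proof eventually_elim
    case (elim x)
    have "symp (sub_adj (fst x))"
      using elim(2) unfolding wf_rooted_def Let_def sub_adj_def by (auto intro!: sympI)
    \<comment> \<open>The first mark of \<open>v\<close> comes from the given percolation, the
      second from the site property of the new one.\<close>
    moreover have "sub_vert (fst x) v" if uv: "sub_adj (fst x) u v" for u v
    proof -
      have "snd (fst (fg x)) u v = Some True" using uv by (simp add: sub_adj_def fg_def forget_def)
      then have "map_option fst (fst (fst x) v) = Some True"
        using elim(3) by (auto simp: is_percolation_marks_def fg_def forget_def)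
      moreover have "snd (the (fst (fst x) v))"
        using elim(4) uv unfolding site_perc_snd_def sub_adj_def by force
      ultimately show ?thesis by (auto simp: sub_vert_def)
    qed
    ultimately show ?case using inner_expansion_ge[OF elim(1)] by blast
  qed

  \<comment> \<open>Since \<open>perc\<close> commutes with relabelling, \<open>f\<close> evaluated
    at the percolated graph is an equivariant transport of the original graph and its coins.\<close>
  have mtp: "(\<integral>\<^sup>+ x. (\<Sum>w. if vert (fst x) w then f ((fst x, snd x), w) else 0) \<partial>M') =
        (\<integral>\<^sup>+ x. (\<Sum>w. if vert (fst x) w then f ((fst x, w), snd x) else 0) \<partial>M')"
    if f[measurable]: "f \<in> borel_measurable drspace" and inv: "invariant2 f" for f
  proof -
    have inv': "f ((relabel \<pi> G, \<pi> r), \<pi> w) = f ((G, r), w)" if "bij \<pi>" for \<pi> G r w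
      using inv that unfolding invariant2_def by blast
    let ?h = "\<lambda>G U r w. f ((perc \<alpha> G U, r), w)"
    have "(\<lambda>p. ((perc \<alpha> (fst (fst (fst p))) (snd p), snd (fst (fst p))), snd (fst p)))
      \<in> measurable (drspace \<Otimes>\<^sub>M coins) drspace"
      by (intro measurable_drspaceI measurable_rspaceI measurable_perc) measurable
    from measurable_compose[OF this f]
    have "(\<integral>\<^sup>+x. \<integral>\<^sup>+U. (\<Sum>w. if vert (fst x) w then ?h (fst x) U (snd x) w else 0) \<partial>coins \<partial>M) =
      (\<integral>\<^sup>+x. \<integral>\<^sup>+U. (\<Sum>w. if vert (fst x) w then ?h (fst x) U w (snd x) else 0) \<partial>coins \<partial>M)"
      by (intro mass_transport_coins[OF assms(1)]) (simp_all add: perc_relabel inv')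
    moreover have "(\<lambda>x. \<Sum>w. if vert (fst x) w then f ((fst x, snd x), w) else 0) \<in> borel_measurable rspace"
      "(\<lambda>x. \<Sum>w. if vert (fst x) w then f ((fst x, w), snd x) else 0) \<in> borel_measurable rspace"
      by measurable
    ultimately show ?thesis by (simp add: nn_M' \<Phi>_def cong: if_cong)
  qed
  have unimod: "unimodular M'"
    unfolding unimodular_def using M'.prob_space_axioms sM' wf mtp by blast

  let ?t = "\<lambda>G U. transport \<alpha> (open_edge G) (open_vert G) U"
  let ?s = "\<lambda>G U. shut \<alpha> (open_edge G) (open_vert G) U"
  let ?R = "{x \<in> space M'. map_option snd (fst (fst x) (snd x)) \<noteq> Some True}"
  have "Measurable.pred rspace (\<lambda>x :: (bool \<times> bool, bool \<times> bool) mgraph \<times> nat.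
      map_option snd (fst (fst x) (snd x)) \<noteq> Some True)"
    by (rule measurable_compose_countable[where g = snd and
      f = "\<lambda>r x. map_option snd (fst (fst x) r) \<noteq> Some True"]) measurable
  then have R: "?R \<in> sets rspace" by (simp add: spM' pred_def)
  have "emeasure M' ?R = (\<integral>\<^sup>+x. indicator ?R x \<partial>M')"
    using R sM' by simp
  also have "\<dots> = (\<integral>\<^sup>+x. \<integral>\<^sup>+U. indicator ?R (\<Phi> (x, U)) \<partial>coins \<partial>M)"
    using R by (intro nn_M') simp
  \<comment> \<open>The root is almost surely a vertex, so if it is not open in the new marking it
    is shut and receives mass at least 1. Extending the senders from open vertices to all vertices
    gives the form required for mass transport.\<close>
  also have "\<dots> \<le> (\<integral>\<^sup>+x. \<integral>\<^sup>+U. (\<Sum>w. if vert (fst x) w then ?t (fst x) U w (snd x) else 0) \<partial>coins \<partial>M)"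
  proof (rule nn_integral_mono_AE)
    show "AE x in M. (\<integral>\<^sup>+U. indicator ?R (\<Phi> (x, U)) \<partial>coins) \<le>
      (\<integral>\<^sup>+U. (\<Sum>w. if vert (fst x) w then ?t (fst x) U w (snd x) else 0) \<partial>coins)"
      using wfM
    proof eventually_elim
      case (elim x)
      have "indicator ?R (\<Phi> (x, U)) \<le> (\<Sum>w. if vert (fst x) w then ?t (fst x) U w (snd x) else 0)" for U
      proof (cases "\<Phi> (x, U) \<in> ?R")
        case True
        have "vert (fst x) (snd x)" using elim by (auto simp: wf_rooted_def Let_def)
        then have "?s (fst x) U (snd x)"
          using True by (auto simp: \<Phi>_def perc_def mark_def vert_def)
        then have "1 \<le> (\<Sum>w. if open_vert (fst x) w then ?t (fst x) U w (snd x) else 0)"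
          by (rule transport_received)
        also have "\<dots> \<le> (\<Sum>w. if vert (fst x) w then ?t (fst x) U w (snd x) else 0)"
          by (intro suminf_le) (auto simp: open_vert_def vert_def)
        finally show ?thesis by (simp add: indicator_def)
      qed simp
      then show ?case by (intro nn_integral_mono)
    qed
  qed
  \<comment> \<open>Mass transport replaces the expected mass received by the expected mass sent,
    which is at most \<alpha> for every graph and all coins.\<close>
  also have "\<dots> = (\<integral>\<^sup>+x. \<integral>\<^sup>+U. (\<Sum>w. if vert (fst x) w then ?t (fst x) U (snd x) w else 0) \<partial>coins \<partial>M)"
  proof (rule mass_transport_coins[OF assms(1), symmetric])
    show "(\<lambda>p. ?t (fst (fst (fst p))) (snd p) (snd (fst (fst p))) (snd (fst p)))
      \<in> borel_measurable (drspace \<Otimes>\<^sub>M coins)"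
      by (intro measurable_transport_open) measurable
    show "?t (relabel \<pi> G) (\<lambda>n v. U n (inv \<pi> v)) (\<pi> r) (\<pi> w) = ?t G U r w" if "bij \<pi>" for \<pi> G U r w
      unfolding open_relabel transport_image[OF bij_imp_bij_inv[OF that]]
      using that by (simp add: bij_is_inj)
  qed
  also have "\<dots> \<le> (\<integral>\<^sup>+x. \<integral>\<^sup>+U. ennreal \<alpha> \<partial>coins \<partial>M)"
  proof (intro nn_integral_mono)
    fix x U
    have "(\<Sum>w. if vert (fst x) w then ?t (fst x) U (snd x) w else 0) \<le> (\<Sum>w. ?t (fst x) U (snd x) w)"
      by (intro suminf_le) auto
    also have "\<dots> \<le> ennreal \<alpha>" by (rule transport_sent[OF \<alpha>])
    finally show "(\<Sum>w. if vert (fst x) w then ?t (fst x) U (snd x) w else 0) \<le> ennreal \<alpha>" .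
  qed
  also have "\<dots> = ennreal \<alpha>"
    by (simp add: C.emeasure_space_1[simplified] M.emeasure_space_1)
  finally have rate: "measure M' ?R \<le> \<alpha>"
    using \<alpha> by (simp add: M'.emeasure_eq_measure)

  have marg: "(\<integral>\<^sup>+ x. g (forget (fst x), snd x) \<partial>M') = (\<integral>\<^sup>+ x. g x \<partial>M)"
    if [measurable]: "g \<in> borel_measurable rspace" for g
  proof -
    have "(\<integral>\<^sup>+ x. g x \<partial>M) = (\<integral>\<^sup>+ x. g x \<partial>distr M' M fg)" unfolding M_eq[symmetric] ..
    also have "\<dots> = (\<integral>\<^sup>+ x. g (fg x) \<partial>M')" by (intro nn_integral_distr) measurable
    finally show ?thesis by (simp add: fg_def)
  qed

  show "\<exists>M' :: ((bool \<times> bool, bool \<times> bool) mgraph \<times> nat) measure.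
       unimodular M' \<and>
       (\<forall>g \<in> borel_measurable rspace. invariant1 g \<longrightarrow>
          (\<integral>\<^sup>+ x. g (forget (fst x), snd x) \<partial>M') = (\<integral>\<^sup>+ x. g x \<partial>M)) \<and>
       (AE x in M'. site_perc_snd (fst x)) \<and>
       measure M' {x \<in> space M'. map_option snd (fst (fst x) (snd x)) \<noteq> Some True} \<le> \<alpha> \<and>
       (AE x in M'. \<forall>C \<in> components (sub_vert (fst x)) (sub_adj (fst x)).
          infinite C \<longrightarrow> inner_expansion (sub_adj (fst x)) C \<ge> \<alpha>)"
    using unimod marg site rate comps by (intro exI[of _ M'] conjI ballI impI)
qed

end
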